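(* (1) $W\equiv0$ is a Bessel potential on $(0,R)$ for any $R>0$. (2) The Bessel function $J_0$ is a positive solution of $(B_W)$ with $W\equiv1$ on $(0,z_0)$, where $z_0=2.4048\ldots$ is the first zero of $J_0$. Moreover, $z_0$ is larger than the first root of any other solution of $(B_1)$ (i.e. any solution not proportional to $J_0$). In other words, for every $R>0$, $\beta(1;R)=\frac{z_0^2}{R^2}$. (3) If $a<2$, then there exists $R_a>0$ such that $W(r)=r^{-a}$ is a Bessel potential on $(0,R_a)$. (4) For each $k\ge1$, $R>0$ and $\rho>R\,E_k$, the equation $(B_{\frac14W_{k,\rho}})$ corresponding to $$W_{k,\rho}(r)=\sum_{j=1}^kU_j(r),\qquad U_j(r)=\frac1{r^2}\Big(\prod_{i=1}^j\log^{(i)}\frac{\rho}{r}\Big)^{-2},$$ has a positive solution on $(0,R)$ that is explicitly given by $\varphi_{k,\rho}(r)=\big(\prod_{i=1}^k\log^{(i)}\frac{\rho}{r}\big)^{\frac12}$. On the other hand, the equation $(B_{\frac14W_{k,\rho}+\lambda U_k})$ has no positive solution on $(0,R)$ for any $\lambda>0$. In other words, $W_{k,\rho}$ is a Bessel potential on $(0,R)$ with $\beta(W_{k,\rho};R)=\frac14$ for any $k\ge1$. (5) For each $k\ge1$ and $R>0$, the equation $(B_{\frac14\tilde W_{k,R}})$ corresponding to $$\tilde W_{k,R}(r)=\sum_{j=1}^k\tilde U_j(r),\qquad\tilde U_j(r)=\frac1{r^2}X_1^2\Big(\frac rR\Big)X_2^2\Big(\frac rR\Big)\cdots X_j^2\Big(\frac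 rR\Big),$$ has a positive solution on $(0,R)$ that is explicitly given by $\varphi_k(r)=\big(X_1(\frac rR)X_2(\frac rR)\cdots X_k(\frac rR)\big)^{-\frac12}$. On the other hand, the equation $(B_{\frac14\tilde W_{k,R}+\lambda\tilde U_k})$ has no positive solution on $(0,R)$ for any $\lambda>0$. In other words, $\tilde W_{k,R}$ is a Bessel potential on $(0,R)$ with $\beta(\tilde W_{k,R};R)=\frac14$ for any $k\ge1$.
   Context: For a function $W$ on $(0,R)$, $(B_W)$ denotes the equation $y''+\frac1r y'+W(r)y=0$. A non-negative $C^1$ function $W$ on $(0,R)$ is a Bessel potential on $(0,R)$ if there is $c>0$ such that $(B_{cW})$ has a positive solution on $(0,R)$; its weight is $\beta(W;R)=\sup\{c>0:\ (B_{cW})\text{ has a positive solution on }(0,R)\}$. $E_k$ is the exponential tower with $k$ copies of $e$: $E_1=e$, $E_{k+1}=e^{E_k}$. $\log^{(1)}=\log$ and $\log^{(k)}(\cdot)=\log(\log^{(k-1)}(\cdot))$ for $k\ge2$. $X_1(t)=(1-\log t)^{-1}$ and $X_k(t)=X_1(X_{k-1}(t))$ for $k\ge2$. *)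

theory Defs
  imports "HOL-Analysis.Analysis"
begin

text \<open>Solutions are classical: \<open>y\<close> is twice differentiable at every point of the interval \<open>I\<close>,
  which is always an open subinterval of \<open>(0, \<infinity>)\<close>.\<close>

definition bessel_solution :: "real set \<Rightarrow> (real \<Rightarrow> real) \<Rightarrow> (real \<Rightarrow> real) \<Rightarrow> bool" where
  "bessel_solution I W y \<longleftrightarrow>
    (\<exists>y' y''. \<forall>r\<in>I.
       (y has_real_derivative y' r) (at r) \<and>
       (y' has_real_derivative y'' r) (at r) \<and>
       y'' r + 1 / r * y' r + W r * y r = 0)"

definition positive_bessel_solution ::
    "real set \<Rightarrow> (real \<Rightarrow> real) \<Rightarrow> (real \<Rightarrow> real) \<Rightarrow> bool" where
  "positive_bessel_solution I W y \<longleftrightarrow> bessel_solution I W y \<and> (\<forall>r\<in>I. 0 < y r)"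

definition bessel_potential :: "(real \<Rightarrow> real) \<Rightarrow> real \<Rightarrow> bool" where
  "bessel_potential W R \<longleftrightarrow>
     (\<forall>r\<in>{0<..<R}. 0 \<le> W r) \<and> W C1_differentiable_on {0<..<R} \<and>
     (\<exists>c>0. \<exists>y. positive_bessel_solution {0<..<R} (\<lambda>r. c * W r) y)"

text \<open>The supremum is taken in the extended reals because it can be infinite
  (for instance for \<open>W = 0\<close>).\<close>

definition bessel_weight :: "(real \<Rightarrow> real) \<Rightarrow> real \<Rightarrow> ereal" where
  "bessel_weight W R =
     (SUP c\<in>{c. 0 < c \<and> (\<exists>y. positive_bessel_solution {0<..<R} (\<lambda>r. c * W r) y)}. ereal c)"

definition bessel_J0 :: "real \<Rightarrow> real" where
  "bessel_J0 x = (\<Sum>m. (-1) ^ m / (fact m)\<^sup>2 * (x / 2) ^ (2 * m))"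

definition bessel_z0 :: real where
  "bessel_z0 = Inf {x. 0 < x \<and> bessel_J0 x = 0}"

definition exp_tower :: "nat \<Rightarrow> real" where
  "exp_tower k = (exp ^^ k) 1"

definition iter_log :: "nat \<Rightarrow> real \<Rightarrow> real" where
  "iter_log k x = (ln ^^ k) x"

definition log_U :: "nat \<Rightarrow> real \<Rightarrow> real \<Rightarrow> real" where
  "log_U j \<rho> r = 1 / r\<^sup>2 * (\<Prod>i=1..j. iter_log i (\<rho> / r)) powi (-2)"

definition log_W :: "nat \<Rightarrow> real \<Rightarrow> real \<Rightarrow> real" where
  "log_W k \<rho> r = (\<Sum>j=1..k. log_U j \<rho> r)"

definition log_phi :: "nat \<Rightarrow> real \<Rightarrow> real \<Rightarrow> real" where
  "log_phi k \<rho> r = (\<Prod>i=1..k. iter_log i (\<rho> / r)) powr (1/2)"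

definition X1 :: "real \<Rightarrow> real" where
  "X1 t = inverse (1 - ln t)"

definition X :: "nat \<Rightarrow> real \<Rightarrow> real" where
  "X k t = (X1 ^^ k) t"

definition X_U :: "nat \<Rightarrow> real \<Rightarrow> real \<Rightarrow> real" where
  "X_U j R r = 1 / r\<^sup>2 * (\<Prod>i=1..j. (X i (r / R))\<^sup>2)"

definition X_W :: "nat \<Rightarrow> real \<Rightarrow> real \<Rightarrow> real" where
  "X_W k R r = (\<Sum>j=1..k. X_U j R r)"

definition X_phi :: "nat \<Rightarrow> real \<Rightarrow> real \<Rightarrow> real" where
  "X_phi k R r = (\<Prod>i=1..k. X i (r / R)) powr (-1/2)"

end

theory Submission
  imports Defs
begin

text \<open>The potentials in (4) and (5) are instances of one construction: put \<open>L\<^sub>0 = \<rho> / r\<close> and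
  \<open>L\<^sub>i\<^sub>+\<^sub>1 = s + ln L\<^sub>i\<close>, with \<open>s = 0\<close> for the iterated logarithms and \<open>s = 1\<close>, \<open>\<rho> = R\<close>
  for the reciprocals of the \<open>X\<^sub>i\<close>. With \<open>P\<^sub>j = L\<^sub>1 \<cdots> L\<^sub>j\<close> one has
  \<open>L\<^sub>j\<^sub>+\<^sub>1' = - 1 / (r P\<^sub>j)\<close>, so that the square root of \<open>P\<^sub>k\<close> solves the equation, and dividing a
  solution by it and passing to the variable \<open>L\<^sub>k\<^sub>+\<^sub>1\<close> turns nonexistence for the perturbed
  potential into the oscillation of \<open>u'' + \<lambda> u = 0\<close> on a half-line.

  For (2), the quotient of a solution by \<open>J\<^sub>0\<close> has derivative \<open>C / (r J\<^sub>0\<^sup>2)\<close> with \<open>C\<close> constant,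
  whence it either is constant or runs monotonically through all reals on \<open>(0, z\<^sub>0)\<close>. The
  equation in (3) reduces to \<open>J\<^sub>0\<close> by a power substitution.\<close>

text \<open>In every weight computed below the supremum is a maximum: the critical equation itself
  has a positive solution, and no larger constant admits one.\<close>

lemma bessel_weight_eqI:
  assumes "0 < \<beta>" "positive_bessel_solution {0<..<R} (\<lambda>r. \<beta> * W r) y"
    and "\<And>c y. \<beta> < c \<Longrightarrow> \<not> positive_bessel_solution {0<..<R} (\<lambda>r. c * W r) y"
  shows "bessel_weight W R = ereal \<beta>"
  unfolding bessel_weight_def
proof (rule antisym)
  show "(SUP c\<in>{c. 0 < c \<and> (\<exists>y. positive_bessel_solution {0<..<R} (\<lambda>r. c * W r) y)}. ereal c) \<le> ereal \<beta>"
    using assms(3) by (intro SUP_least) (force simp: not_less[symmetric])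
  show "ereal \<beta> \<le> (SUP c\<in>{c. 0 < c \<and> (\<exists>y. positive_bessel_solution {0<..<R} (\<lambda>r. c * W r) y)}. ereal c)"
    using assms(1,2) by (intro SUP_upper) auto
qed

section \<open>The Bessel function \<open>J\<^sub>0\<close>\<close>

definition bessel_coeff :: "nat \<Rightarrow> real" where
  "bessel_coeff m = (-1) ^ m / (fact m)\<^sup>2"

text \<open>The variable z = x^2 / 4 turns the even series of J_0 into an ordinary power series, to
  which termwise differentiation by \<open>diffs\<close> applies directly.\<close>

definition bessel_series :: "real \<Rightarrow> real" where
  "bessel_series z = (\<Sum>m. bessel_coeff m * z ^ m)"

definition bessel_series' :: "real \<Rightarrow> real" where
  "bessel_series' z = (\<Sum>m. diffs bessel_coeff m * z ^ m)"

definition bessel_series'' :: "real \<Rightarrow> real" where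
  "bessel_series'' z = (\<Sum>m. diffs (diffs bessel_coeff) m * z ^ m)"

lemma bessel_J0_eq: "bessel_J0 x = bessel_series (x\<^sup>2 / 4)"
  by (simp add: bessel_J0_def bessel_series_def bessel_coeff_def power_mult power_divide)

lemma summable_bessel_coeff: "summable (\<lambda>m. bessel_coeff m * z ^ m)"
proof (rule summable_comparison_test')
  show "summable (\<lambda>m. \<bar>z\<bar> ^ m / fact m)"
    using summable_exp[of "\<bar>z\<bar>"] by (simp add: divide_inverse mult.commute)
  fix m :: nat
  have "(fact m :: real) * 1 \<le> fact m * fact m"
    by (intro mult_left_mono) auto
  then show "norm (bessel_coeff m * z ^ m) \<le> \<bar>z\<bar> ^ m / fact m"
    by (simp add: bessel_coeff_def abs_mult power_abs power2_eq_square frac_le)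
qed

lemma summable_diffs_bessel_coeff: "summable (\<lambda>m. diffs bessel_coeff m * z ^ m)"
  by (rule termdiff_converges_all) (rule summable_bessel_coeff)

lemma summable_diffs2_bessel_coeff: "summable (\<lambda>m. diffs (diffs bessel_coeff) m * z ^ m)"
  by (rule termdiff_converges_all) (rule summable_diffs_bessel_coeff)

lemma bessel_series_deriv: "(bessel_series has_real_derivative bessel_series' z) (at z)"
  unfolding bessel_series_def[abs_def] bessel_series'_def
  by (rule termdiffs_strong_converges_everywhere) (rule summable_bessel_coeff)

lemma bessel_series'_deriv: "(bessel_series' has_real_derivative bessel_series'' z) (at z)"
  unfolding bessel_series'_def[abs_def] bessel_series''_def
  by (rule termdiffs_strong_converges_everywhere) (rule summable_diffs_bessel_coeff)

text \<open>This is (B_1) written in z = x^2 / 4. It holds coefficientwise, by the recursion a_(m+1)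
  = - a_m / (m + 1)^2.\<close>

lemma bessel_series_ode: "z * bessel_series'' z + bessel_series' z + bessel_series z = 0"
proof -
  let ?d = "diffs bessel_coeff"
  have "(\<lambda>m. real m * ?d m * z ^ (m - Suc 0)) sums bessel_series'' z"
    unfolding bessel_series''_def by (rule diffs_equiv[OF summable_diffs2_bessel_coeff])
  then have "(\<lambda>m. z * (real m * ?d m * z ^ (m - Suc 0))) sums (z * bessel_series'' z)"
    by (rule sums_mult)
  \<comment> \<open>At \<open>m = 0\<close> the truncated exponent breaks the power law, but the
    factor \<open>real m\<close> vanishes.\<close>
  moreover have "z * (real m * ?d m * z ^ (m - Suc 0)) = real m * ?d m * z ^ m" for m
    by (cases m) auto
  ultimately have "(\<lambda>m. real m * ?d m * z ^ m) sums (z * bessel_series'' z)" by simp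
  moreover have "(\<lambda>m. ?d m * z ^ m) sums bessel_series' z"
    unfolding bessel_series'_def by (rule summable_sums[OF summable_diffs_bessel_coeff])
  moreover have "(\<lambda>m. bessel_coeff m * z ^ m) sums bessel_series z"
    unfolding bessel_series_def by (rule summable_sums[OF summable_bessel_coeff])
  ultimately have "(\<lambda>m. real m * ?d m * z ^ m + ?d m * z ^ m + bessel_coeff m * z ^ m) sums
      (z * bessel_series'' z + bessel_series' z + bessel_series z)"
    by (intro sums_add)
  moreover have "real m * ?d m + ?d m + bessel_coeff m = 0" for m
    by (simp add: diffs_def bessel_coeff_def divide_simps power2_eq_square) (simp add: algebra_simps)
  then have "real m * ?d m * z ^ m + ?d m * z ^ m + bessel_coeff m * z ^ m = 0" for m
    by (metis distrib_right mult_zero_left)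
  ultimately show ?thesis
    by (simp add: sums_unique2[OF _ sums_zero])
qed

section \<open>Alternating series estimates and numerical values\<close>

lemma alternating_suminf_bounds:
  fixes a :: "nat \<Rightarrow> real"
  assumes "\<And>n. 0 \<le> a n" "\<And>n. a (Suc n) \<le> a n" "summable (\<lambda>n. (-1) ^ n * a n)"
  shows "(\<Sum>i<2*n. (-1) ^ i * a i) \<le> (\<Sum>i. (-1) ^ i * a i)"
    and "(\<Sum>i. (-1) ^ i * a i) \<le> (\<Sum>i<2*n+1. (-1) ^ i * a i)"
proof -
  \<comment> \<open>Leibniz's criterion requires that \<open>a\<close> tend to 0; this is recovered
    from the summability of the signed series.\<close>
  have "(\<lambda>n. \<bar>(-1) ^ n * a n\<bar>) \<longlonglongrightarrow> 0"
    using summable_LIMSEQ_zero[OF assms(3)] by (rule tendsto_rabs_zero)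
  then have "a \<longlonglongrightarrow> 0"
    using assms(1) by (simp add: abs_mult power_abs)
  then show "(\<Sum>i<2*n. (-1) ^ i * a i) \<le> (\<Sum>i. (-1) ^ i * a i)"
    "(\<Sum>i. (-1) ^ i * a i) \<le> (\<Sum>i<2*n+1. (-1) ^ i * a i)"
    using summable_Leibniz'(2,4)[of a n] assms by auto
qed

text \<open>The constant term is split off since the terms decrease only from index 1 on when \<open>z > 1\<close>.\<close>

lemma bessel_series_bounds:
  assumes "0 \<le> z" "z \<le> 4"
  shows "1 - (\<Sum>i<2*n+1. (-1) ^ i * (z ^ Suc i / (fact (Suc i))\<^sup>2)) \<le> bessel_series z"
    and "bessel_series z \<le> 1 - (\<Sum>i<2*n. (-1) ^ i * (z ^ Suc i / (fact (Suc i))\<^sup>2))"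
proof -
  define a where "a i = z ^ Suc i / (fact (Suc i))\<^sup>2" for i
  have eq: "bessel_coeff (Suc i) * z ^ Suc i = - ((-1) ^ i * a i)" for i
    by (simp add: bessel_coeff_def a_def)
  have s: "summable (\<lambda>i. - ((-1) ^ i * a i))"
    using summable_bessel_coeff[of z] unfolding eq[symmetric]
    by (subst summable_Suc_iff)
  have "bessel_series z = bessel_coeff 0 + (\<Sum>i. - ((-1) ^ i * a i))"
    using suminf_split_head[OF summable_bessel_coeff[of z]] eq
    by (simp add: bessel_series_def)
  also have "\<dots> = 1 - (\<Sum>i. (-1) ^ i * a i)"
    using s by (subst suminf_minus) (auto simp: bessel_coeff_def summable_minus_iff)
  finally have f: "bessel_series z = 1 - (\<Sum>i. (-1) ^ i * a i)" .
  have "0 \<le> a i" for i using assms by (simp add: a_def)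
  moreover have "a (Suc i) \<le> a i" for i
  proof -
    \<comment> \<open>The ratio of consecutive terms is z / (i + 2)^2, at most 1 because z \<le>
      4.\<close>
    have "2 ^ 2 \<le> (real (Suc (Suc i)))\<^sup>2" by (rule power_mono) auto
    then have "z \<le> (real (Suc (Suc i)))\<^sup>2" using assms by simp
    then have "z / (real (Suc (Suc i)))\<^sup>2 \<le> 1"
      by (simp add: divide_le_eq_1)
    moreover have "a (Suc i) = a i * (z / (real (Suc (Suc i)))\<^sup>2)"
      by (simp add: a_def power_mult_distrib mult_ac)
    ultimately show ?thesis using \<open>0 \<le> a i\<close> by (metis mult_left_le)
  qed
  moreover have "summable (\<lambda>i. (-1) ^ i * a i)" using s by (simp add: summable_minus_iff)
  ultimately show "1 - (\<Sum>i<2*n+1. (-1) ^ i * (z ^ Suc i / (fact (Suc i))\<^sup>2)) \<le> bessel_series z"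
    "bessel_series z \<le> 1 - (\<Sum>i<2*n. (-1) ^ i * (z ^ Suc i / (fact (Suc i))\<^sup>2))"
    using alternating_suminf_bounds[of a n] unfolding f a_def by auto
qed

text \<open>The derivative is minus an alternating series whose terms decrease from the start, with
  ratios z / ((i + 1) (i + 2)). Its first two terms leave 1 - z / 2, which is positive for z <
  2.\<close>

lemma bessel_series'_neg:
  assumes "0 \<le> z" "z < 2"
  shows "bessel_series' z < 0"
proof -
  define a where "a i = z ^ i / (fact i * fact (Suc i))" for i
  have eq: "diffs bessel_coeff i * z ^ i = - ((-1) ^ i * a i)" for i
    by (simp add: diffs_def bessel_coeff_def a_def divide_simps power2_eq_square)
  have s: "summable (\<lambda>i. - ((-1) ^ i * a i))"
    using summable_diffs_bessel_coeff[of z] unfolding eq .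
  then have s': "summable (\<lambda>i. (-1) ^ i * a i)" by (simp add: summable_minus_iff)
  have f: "bessel_series' z = - (\<Sum>i. (-1) ^ i * a i)"
    unfolding bessel_series'_def eq using s' by (rule suminf_minus)
  have "0 \<le> a i" for i using assms by (simp add: a_def)
  moreover have "a (Suc i) \<le> a i" for i
  proof -
    have "1 * 2 \<le> real (Suc i) * real (Suc (Suc i))" by (rule mult_mono) auto
    then have "z / (real (Suc i) * real (Suc (Suc i))) \<le> 1"
      using assms by (simp add: divide_le_eq_1)
    moreover have "a (Suc i) = a i * (z / (real (Suc i) * real (Suc (Suc i))))"
      by (simp add: a_def mult_ac)
    ultimately show ?thesis using \<open>0 \<le> a i\<close> by (metis mult_left_le)
  qed
  ultimately have "(\<Sum>i<2*1. (-1) ^ i * a i) \<le> (\<Sum>i. (-1) ^ i * a i)"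
    using s' by (intro alternating_suminf_bounds) auto
  then show ?thesis using assms f by (simp add: a_def numeral_2_eq_2)
qed

text \<open>The value is only of order 10^-5, so the lower bound by the partial sum of degree 7 in z
  is used; at 2.4049 the sum of degree 8 gives the upper bound.\<close>

lemma bessel_series_at_lower: "0 < bessel_series (2.4048\<^sup>2 / 4)"
  by (rule less_le_trans[OF _ bessel_series_bounds(1)[of _ 3]])
    (simp_all add: lessThan_nat_numeral fact_numeral power_divide)

lemma bessel_series_at_upper: "bessel_series (2.4049\<^sup>2 / 4) < 0"
  by (rule le_less_trans[OF bessel_series_bounds(2)[of _ 4]])
    (simp_all add: lessThan_nat_numeral fact_numeral power_divide)

section \<open>J_0 as a solution of (B_1) and its first zero\<close>

definition bessel_J0' :: "real \<Rightarrow> real" where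
  "bessel_J0' x = bessel_series' (x\<^sup>2 / 4) * (x / 2)"

lemma bessel_J0_deriv: "(bessel_J0 has_real_derivative bessel_J0' x) (at x)"
proof -
  have "((\<lambda>x. bessel_series (x\<^sup>2 / 4)) has_real_derivative bessel_series' (x\<^sup>2 / 4) * (x / 2)) (at x)"
    by (rule DERIV_chain2[OF bessel_series_deriv]) (auto intro!: derivative_eq_intros)
  then show ?thesis by (simp add: bessel_J0_eq[abs_def] bessel_J0'_def)
qed

text \<open>The chain rule together with \<open>bessel_series_ode\<close>, solved for the second
  derivative.\<close>

lemma bessel_J0'_deriv:
  assumes "x \<noteq> 0"
  shows "(bessel_J0' has_real_derivative - bessel_J0' x / x - bessel_J0 x) (at x)"
proof -
  let ?z = "x\<^sup>2 / 4"
  have "((\<lambda>x. bessel_series' (x\<^sup>2 / 4)) has_real_derivative bessel_series'' ?z * (x / 2)) (at x)"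
    by (rule DERIV_chain2[OF bessel_series'_deriv]) (auto intro!: derivative_eq_intros)
  then have deriv: "(bessel_J0' has_real_derivative
      bessel_series'' ?z * (x / 2) * (x / 2) + bessel_series' ?z / 2) (at x)"
    unfolding bessel_J0'_def[abs_def] by (auto intro!: derivative_eq_intros)
  have "bessel_series'' ?z * (x / 2) * (x / 2) = ?z * bessel_series'' ?z"
    by (simp add: power2_eq_square)
  moreover have "\<dots> = - bessel_series' ?z - bessel_series ?z"
    using bessel_series_ode[of ?z] by linarith
  moreover have "bessel_J0' x / x = bessel_series' ?z / 2" "bessel_J0 x = bessel_series ?z"
    using assms by (simp_all add: bessel_J0'_def bessel_J0_eq)
  ultimately have "bessel_series'' ?z * (x / 2) * (x / 2) + bessel_series' ?z / 2 =
      - bessel_J0' x / x - bessel_J0 x"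
    by linarith
  with deriv show ?thesis by (simp only:)
qed

lemma isCont_bessel_J0: "isCont bessel_J0 x"
  using bessel_J0_deriv DERIV_isCont by blast

lemma bessel_solution_J0: "0 \<notin> I \<Longrightarrow> bessel_solution I (\<lambda>r. 1) bessel_J0"
  unfolding bessel_solution_def
  by (rule exI[of _ bessel_J0'], rule exI[of _ "\<lambda>x. - bessel_J0' x / x - bessel_J0 x"],
      intro ballI conjI bessel_J0_deriv bessel_J0'_deriv) auto

text \<open>\<open>bessel_series\<close> decreases on the range of x^2 / 4, as 2.4048^2 / 4 < 2, so
  positivity at the right end is enough.\<close>

lemma bessel_J0_pos_lower:
  assumes "0 \<le> x" "x \<le> 2.4048"
  shows "0 < bessel_J0 x"
proof -
  have sq: "x\<^sup>2 / 4 \<le> 2.4048\<^sup>2 / 4"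
    using assms by (intro divide_right_mono power_mono) auto
  have "bessel_series (2.4048\<^sup>2 / 4) \<le> bessel_series (x\<^sup>2 / 4)"
  proof (rule DERIV_nonpos_imp_nonincreasing[OF sq])
    fix z :: real assume z: "x\<^sup>2 / 4 \<le> z" "z \<le> 2.4048\<^sup>2 / 4"
    then have "0 \<le> z" by (meson order_trans zero_le_divide_iff zero_le_numeral zero_le_power2)
    moreover have "z < 2" using z(2) by (simp add: power2_eq_square)
    ultimately show "\<exists>D. (bessel_series has_real_derivative D) (at z) \<and> D \<le> 0"
      using bessel_series_deriv bessel_series'_neg by (meson less_imp_le)
  qed
  with bessel_series_at_lower show ?thesis by (simp add: bessel_J0_eq)
qed

lemma bessel_J0_zero_ge:
  assumes "0 < x" "bessel_J0 x = 0"
  shows "2.4048 \<le> x"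
  using bessel_J0_pos_lower[of x] assms by fastforce

lemma bessel_J0_zero_exists:
  assumes "0 \<le> b" "bessel_J0 b \<le> 0"
  obtains x where "0 < x" "x \<le> b" "bessel_J0 x = 0"
proof -
  have "0 < bessel_J0 0" by (rule bessel_J0_pos_lower) auto
  moreover obtain x where "0 \<le> x" "x \<le> b" "bessel_J0 x = 0"
    using IVT2[of bessel_J0 b 0 0] assms \<open>0 < bessel_J0 0\<close> isCont_bessel_J0 by auto
  ultimately show ?thesis by (intro that[of x]) (auto simp: less_le)
qed

lemma bdd_below_bessel_zeros: "bdd_below {x. 0 < x \<and> bessel_J0 x = 0}"
  by (rule bdd_belowI[of _ 0]) auto

lemma bessel_z0_le: "0 < x \<Longrightarrow> bessel_J0 x = 0 \<Longrightarrow> bessel_z0 \<le> x"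
  unfolding bessel_z0_def by (rule cInf_lower[OF _ bdd_below_bessel_zeros]) auto

lemma bessel_J0_upper_neg: "bessel_J0 2.4049 < 0"
  unfolding bessel_J0_eq by (rule bessel_series_at_upper)

lemma bessel_z0_props: "bessel_J0 bessel_z0 = 0" "2.4048 \<le> bessel_z0" "bessel_z0 < 2.4049"
proof -
  let ?Z = "{x. 0 < x \<and> bessel_J0 x = 0}"
  obtain x where x: "0 < x" "x \<le> 2.4049" "bessel_J0 x = 0"
    using bessel_J0_zero_exists[of "2.4049"] bessel_J0_upper_neg by auto
  \<comment> \<open>The condition 0 < x is not closed; since there are no zeros below 2.4048 it may
    be replaced by a closed one, so the infimum is attained.\<close>
  have "?Z = {2.4048..} \<inter> bessel_J0 -` {0}"
    using bessel_J0_zero_ge by fastforce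
  moreover have "closed ({2.4048..} \<inter> bessel_J0 -` {0})"
    using isCont_bessel_J0
    by (intro closed_Int closed_vimage closed_atLeast closed_singleton continuous_at_imp_continuous_on) auto
  ultimately have "bessel_z0 \<in> ?Z"
    unfolding bessel_z0_def using x
    by (intro closed_contains_Inf bdd_below_bessel_zeros) auto
  then show "bessel_J0 bessel_z0 = 0" "2.4048 \<le> bessel_z0"
    using bessel_J0_zero_ge by auto
  have "x \<noteq> 2.4049" using x(3) bessel_J0_upper_neg by (metis less_irrefl)
  then show "bessel_z0 < 2.4049" using bessel_z0_le[OF x(1,3)] x(2) by linarith
qed

lemma bessel_z0_pos: "0 < bessel_z0"
  using bessel_z0_props(2) by (rule less_le_trans[rotated]) simp

lemma bessel_J0_pos:
  assumes "0 \<le> x" "x < bessel_z0"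
  shows "0 < bessel_J0 x"
proof (rule ccontr)
  assume "\<not> 0 < bessel_J0 x"
  then obtain t where "0 < t" "t \<le> x" "bessel_J0 t = 0"
    using bessel_J0_zero_exists[of x] assms by auto
  then show False using bessel_z0_le[of t] assms by simp
qed

lemma positive_solution_J0: "positive_bessel_solution {0<..<bessel_z0} (\<lambda>r. 1) bessel_J0"
  unfolding positive_bessel_solution_def by (auto intro!: bessel_solution_J0 bessel_J0_pos)

section \<open>Comparison of arbitrary solutions with J_0\<close>

lemma bessel_J0_upper_bounds:
  obtains K where "0 < K" "\<And>x. 0 \<le> x \<Longrightarrow> x \<le> bessel_z0 \<Longrightarrow> bessel_J0 x \<le> K"
    "\<And>x. 0 \<le> x \<Longrightarrow> x \<le> bessel_z0 \<Longrightarrow> bessel_J0 x \<le> K * (bessel_z0 - x)"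
proof -
  have "continuous_on UNIV bessel_series'"
    by (intro continuous_at_imp_continuous_on ballI DERIV_isCont[OF bessel_series'_deriv])
  then have "continuous_on {0..bessel_z0} (\<lambda>x. bessel_series' (x\<^sup>2 / 4))"
    by (rule continuous_on_compose2) (auto intro!: continuous_intros)
  then have "continuous_on {0..bessel_z0} bessel_J0'"
    unfolding bessel_J0'_def[abs_def] by (intro continuous_intros) auto
  then have "bounded (bessel_J0' ` {0..bessel_z0})"
    by (intro compact_imp_bounded compact_continuous_image) auto
  then obtain K where K: "0 < K" "\<And>x. 0 \<le> x \<Longrightarrow> x \<le> bessel_z0 \<Longrightarrow> \<bar>bessel_J0' x\<bar> \<le> K"
    unfolding bounded_pos by auto
  \<comment> \<open>Since J_0 vanishes at z_0, the bound on its derivative becomes a linear bound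
    there. Later this makes 1 / (r J_0^2) nonintegrable at z_0.\<close>
  have lip: "bessel_J0 x \<le> K * (bessel_z0 - x)" if x: "0 \<le> x" "x \<le> bessel_z0" for x
  proof -
    have "bessel_J0 x + K * x \<le> bessel_J0 bessel_z0 + K * bessel_z0"
    proof (rule DERIV_nonneg_imp_nondecreasing[OF x(2)])
      fix t assume t: "x \<le> t" "t \<le> bessel_z0"
      have "((\<lambda>x. bessel_J0 x + K * x) has_real_derivative bessel_J0' t + K) (at t)"
        by (auto intro!: derivative_eq_intros bessel_J0_deriv)
      moreover have "0 \<le> bessel_J0' t + K" using K(2)[of t] t x by auto
      ultimately show "\<exists>D. ((\<lambda>x. bessel_J0 x + K * x) has_real_derivative D) (at t) \<and> 0 \<le> D" by blast
    qed
    then show ?thesis by (simp add: bessel_z0_props algebra_simps)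
  qed
  show ?thesis
  \<comment> \<open>The maximum lets one constant serve both the uniform and the linear
    bound.\<close>
  proof (rule that[of "max K (K * bessel_z0)"])
    fix x assume x: "0 \<le> x" "x \<le> bessel_z0"
    have "K * (bessel_z0 - x) \<le> K * bessel_z0" using K(1) x by simp
    then show "bessel_J0 x \<le> max K (K * bessel_z0)" using lip[OF x] by linarith
    have "K * (bessel_z0 - x) \<le> max K (K * bessel_z0) * (bessel_z0 - x)"
      using x by (intro mult_right_mono) auto
    then show "bessel_J0 x \<le> max K (K * bessel_z0) * (bessel_z0 - x)" using lip[OF x] by linarith
  qed (use K in auto)
qed

text \<open>The energy \<open>y\<^sup>2 + y'\<^sup>2\<close> is nonincreasing along solutions.\<close>

lemma bessel_solution_zero_forward:
  assumes deriv: "\<And>x. a \<le> x \<Longrightarrow> x \<le> b \<Longrightarrow> (y has_real_derivative y' x) (at x)"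
    "\<And>x. a \<le> x \<Longrightarrow> x \<le> b \<Longrightarrow> (y' has_real_derivative - y' x / x - y x) (at x)"
    and "0 < a" "a \<le> b" "y a = 0" "y' a = 0"
  shows "y b = 0"
proof -
  have "(y b)\<^sup>2 + (y' b)\<^sup>2 \<le> (y a)\<^sup>2 + (y' a)\<^sup>2"
  proof (rule DERIV_nonpos_imp_nonincreasing[OF \<open>a \<le> b\<close>])
    fix x assume x: "a \<le> x" "x \<le> b"
    have "((\<lambda>x. (y x)\<^sup>2 + (y' x)\<^sup>2) has_real_derivative
        2 * y x * y' x + 2 * y' x * (- y' x / x - y x)) (at x)"
      using deriv[OF x] by (auto intro!: derivative_eq_intros)
    moreover have "2 * y x * y' x + 2 * y' x * (- y' x / x - y x) = - (2 * (y' x)\<^sup>2 / x)"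
      by (simp add: power2_eq_square algebra_simps)
    then have "2 * y x * y' x + 2 * y' x * (- y' x / x - y x) \<le> 0" using x \<open>0 < a\<close> by simp
    ultimately show "\<exists>D. ((\<lambda>x. (y x)\<^sup>2 + (y' x)\<^sup>2) has_real_derivative D) (at x) \<and> D \<le> 0"
      by blast
  qed
  then have "(y b)\<^sup>2 + (y' b)\<^sup>2 \<le> 0" using assms by simp
  then show ?thesis by (simp add: sum_power2_le_zero_iff)
qed

text \<open>If the Wronskian \<open>C = r (J\<^sub>0 y' - J\<^sub>0' y)\<close> is positive, then \<open>u = y / J\<^sub>0\<close> has
  \<open>u' = C / (r J\<^sub>0\<^sup>2)\<close>; this is not integrable at \<open>0\<close> (logarithmically) nor at \<open>z\<^sub>0\<close>, where
  \<open>J\<^sub>0\<close> vanishes, so \<open>u\<close> increases from minus to plus infinity.\<close>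

lemma zero_of_increasing_quotient:
  assumes C: "0 < C"
    and u: "\<And>r. 0 < r \<Longrightarrow> r < bessel_z0 \<Longrightarrow>
      (u has_real_derivative C / (r * (bessel_J0 r)\<^sup>2)) (at r)"
  shows "\<exists>x. 0 < x \<and> x < bessel_z0 \<and> u x = 0 \<and> (\<forall>r\<in>{0<..<x}. u r \<noteq> 0)"
proof -
  obtain K where K: "0 < K" "\<And>x. 0 \<le> x \<Longrightarrow> x \<le> bessel_z0 \<Longrightarrow> bessel_J0 x \<le> K"
    "\<And>x. 0 \<le> x \<Longrightarrow> x \<le> bessel_z0 \<Longrightarrow> bessel_J0 x \<le> K * (bessel_z0 - x)"
    using bessel_J0_upper_bounds by blast
  define m where "m = bessel_z0 / 2"
  have m: "0 < m" "m < bessel_z0" using bessel_z0_pos by (auto simp: m_def)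
  have u_less: "u r < u t" if "0 < r" "r < t" "t < bessel_z0" for r t
  proof (rule DERIV_pos_imp_increasing[OF that(2)])
    fix x assume x: "r \<le> x" "x \<le> t"
    have "0 < C / (x * (bessel_J0 x)\<^sup>2)"
      using x that C bessel_J0_pos[of x] by (intro divide_pos_pos mult_pos_pos zero_less_power) auto
    then show "\<exists>D. (u has_real_derivative D) (at x) \<and> 0 < D"
      using u[of x] x that by force
  qed
  obtain r where r: "0 < r" "r < bessel_z0" "u r < 0"
  proof -
    \<comment> \<open>From J_0 \<le> K one gets u' \<ge> A / r, so \<open>u r - A * ln r\<close> is
      nondecreasing on (0, m].\<close>
    define A where "A = C / K\<^sup>2"
    have A: "0 < A" using C K by (simp add: A_def)
    have le: "u r - A * ln r \<le> u m - A * ln m" if r: "0 < r" "r \<le> m" for r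
    proof (rule DERIV_nonneg_imp_nondecreasing[OF r(2)])
      fix x assume x: "r \<le> x" "x \<le> m"
      then have x': "0 < x" "x < bessel_z0" using r m by auto
      have "((\<lambda>r. u r - A * ln r) has_real_derivative C / (x * (bessel_J0 x)\<^sup>2) - A / x) (at x)"
        using u[OF x'] x' by (auto intro!: derivative_eq_intros)
      moreover have "A / x \<le> C / (x * (bessel_J0 x)\<^sup>2)"
      proof -
        have "x * (bessel_J0 x)\<^sup>2 \<le> x * K\<^sup>2"
          using x' K(2)[of x] bessel_J0_pos[of x] by (intro mult_left_mono power_mono) auto
        then have "C / (x * K\<^sup>2) \<le> C / (x * (bessel_J0 x)\<^sup>2)"
          using x' C K bessel_J0_pos[of x] by (intro divide_left_mono mult_pos_pos zero_less_power) auto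
        then show ?thesis by (simp add: A_def mult.commute)
      qed
      ultimately show "\<exists>D. ((\<lambda>r. u r - A * ln r) has_real_derivative D) (at x) \<and> 0 \<le> D"
        by force
    qed
    \<comment> \<open>With this \<open>b\<close>, ln r \<le> b gives u(r) \<le> - A.\<close>
    define b where "b = (A * ln m - u m) / A - 1"
    define r where "r = min m (exp b)"
    have r: "0 < r" "r \<le> m" "r \<le> exp b" using m by (auto simp: r_def)
    have "ln r \<le> b" using r by (metis exp_gt_zero ln_exp ln_mono)
    then have "A * ln r \<le> A * b" using A by simp
    also have "A * b = A * ln m - u m - A" using A by (simp add: b_def field_simps)
    finally have "u r < 0" using le[OF r(1,2)] A by linarith
    then show ?thesis using that[of r] r m by auto
  qed
  obtain t where t: "0 < t" "t < bessel_z0" "0 < u t"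
  proof -
    \<comment> \<open>Here the linear bound on J_0 and r \<le> z_0 give u' \<ge> A / (z_0 - r)^2,
      the derivative of A / (z_0 - r).\<close>
    define A where "A = C / (bessel_z0 * K\<^sup>2)"
    have A: "0 < A" using C K bessel_z0_pos by (simp add: A_def)
    have le: "u m - A * inverse (bessel_z0 - m) \<le> u r - A * inverse (bessel_z0 - r)"
      if r: "m \<le> r" "r < bessel_z0" for r
    proof (rule DERIV_nonneg_imp_nondecreasing[OF r(1)])
      fix x assume x: "m \<le> x" "x \<le> r"
      then have x': "0 < x" "x < bessel_z0" using r m by auto
      have "((\<lambda>r. u r - A * inverse (bessel_z0 - r)) has_real_derivative
          C / (x * (bessel_J0 x)\<^sup>2) - A / (bessel_z0 - x)\<^sup>2) (at x)"
        using u[OF x'] x'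
        by (auto intro!: derivative_eq_intros simp: power2_eq_square divide_inverse)
      moreover have "A / (bessel_z0 - x)\<^sup>2 \<le> C / (x * (bessel_J0 x)\<^sup>2)"
      proof -
        have "x * (bessel_J0 x)\<^sup>2 \<le> bessel_z0 * (K * (bessel_z0 - x))\<^sup>2"
          using x' K(3)[of x] bessel_J0_pos[of x] by (intro mult_mono power_mono) auto
        then have "C / (bessel_z0 * (K * (bessel_z0 - x))\<^sup>2) \<le> C / (x * (bessel_J0 x)\<^sup>2)"
          using x' C K bessel_J0_pos[of x] by (intro divide_left_mono mult_pos_pos zero_less_power) auto
        then show ?thesis by (simp add: A_def power_mult_distrib mult_ac)
      qed
      ultimately show "\<exists>D. ((\<lambda>r. u r - A * inverse (bessel_z0 - r)) has_real_derivative D) (at x) \<and> 0 \<le> D"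
        by force
    qed
    \<comment> \<open>The distance from \<open>t\<close> to z_0 will be 1 / b. The first entry keeps
      t \<ge> m; the second makes the lower bound for u(t) at least A.\<close>
    define b where "b = max (inverse (bessel_z0 - m)) ((A * inverse (bessel_z0 - m) - u m) / A + 1)"
    define t where "t = bessel_z0 - inverse b"
    have b: "0 < b" using m by (auto simp: b_def less_max_iff_disj)
    have "inverse b \<le> bessel_z0 - m"
      using m le_imp_inverse_le[of "inverse (bessel_z0 - m)" b] by (simp add: b_def)
    then have t: "m \<le> t" "t < bessel_z0" using b by (auto simp: t_def)
    have "A * ((A * inverse (bessel_z0 - m) - u m) / A + 1) \<le> A * b"
      using A by (intro mult_left_mono) (auto simp: b_def)
    moreover have "A * ((A * inverse (bessel_z0 - m) - u m) / A + 1) =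
        A * inverse (bessel_z0 - m) - u m + A"
      using A by (simp add: field_simps)
    moreover have "inverse (bessel_z0 - t) = b" by (simp add: t_def)
    ultimately have "0 < u t" using le[OF t] A by simp
    then show ?thesis using that[of t] t m by auto
  qed
  have "r < t" using u_less[of t r] r t by (metis less_asym less_trans linorder_neqE_linordered_idom)
  then obtain x where x: "r \<le> x" "x \<le> t" "u x = 0"
    using IVT[of u r 0 t] r t u DERIV_isCont by (smt (verit))
  then have "u s < 0" if "s \<in> {0<..<x}" for s
    using u_less[of s x] that t by auto
  then show ?thesis using x r t by (intro exI[of _ x]) force
qed

text \<open>By Abel's identity r times the Wronskian of J_0 and y is a constant C. If C = 0, y is
  proportional to J_0; otherwise y / J_0 or its negative is an increasing quotient that runs through
  0.\<close>

lemma first_zero_less_bessel_z0: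
  assumes I: "I = {0<..} \<or> (\<exists>R\<ge>bessel_z0. I = {0<..<R})"
    and sol: "bessel_solution I (\<lambda>r. 1) y"
    and nprop: "\<not> (\<exists>c. \<forall>r\<in>I. y r = c * bessel_J0 r)"
  shows "\<exists>x. 0 < x \<and> x < bessel_z0 \<and> y x = 0 \<and> (\<forall>r\<in>{0<..<x}. y r \<noteq> 0)"
proof -
  obtain y' y'' where y: "\<And>r. r \<in> I \<Longrightarrow> (y has_real_derivative y' r) (at r)"
    "\<And>r. r \<in> I \<Longrightarrow> (y' has_real_derivative y'' r) (at r)"
    "\<And>r. r \<in> I \<Longrightarrow> y'' r + 1 / r * y' r + 1 * y r = 0"
    using sol unfolding bessel_solution_def by metis
  have y'_deriv: "(y' has_real_derivative - y' r / r - y r) (at r)" if "r \<in> I" for r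
  proof -
    have "y'' r = - y' r / r - y r" using y(3)[OF that] by simp
    with y(2)[OF that] show ?thesis by simp
  qed
  have I_pos: "0 < r" if "r \<in> I" for r using that I by auto
  have I_sub: "r \<in> I" if "0 < r" "r < bessel_z0" for r using that I by auto
  have I_conv: "x \<in> I" if "b \<in> I" "0 < a" "a \<le> x" "x \<le> b" for a b x
    using that I by auto
  define w where "w r = r * (bessel_J0 r * y' r - bessel_J0' r * y r)" for r
  have w_deriv: "(w has_real_derivative 0) (at r)" if "r \<in> I" for r
    unfolding w_def[abs_def]
    using y(1)[OF that] y'_deriv[OF that] bessel_J0_deriv[of r] bessel_J0'_deriv[of r] I_pos[OF that]
    by (auto intro!: derivative_eq_intros simp: field_simps)
  define m where "m = bessel_z0 / 2"
  have m: "0 < m" "m < bessel_z0" using bessel_z0_pos by (auto simp: m_def)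
  define C where "C = w m"
  have w_C: "w r = C" if "0 < r" "r < bessel_z0" for r
  proof -
    have "\<exists>c. \<forall>x\<in>{0<..<bessel_z0}. w x = c"
      using w_deriv I_sub
      by (intro has_field_derivative_zero_constant) (auto intro: has_field_derivative_at_within)
    with that m show ?thesis by (auto simp: C_def)
  qed
  define u where "u r = y r / bessel_J0 r" for r
  have u_deriv: "(u has_real_derivative C / (r * (bessel_J0 r)\<^sup>2)) (at r)"
    if r: "0 < r" "r < bessel_z0" for r
    unfolding u_def[abs_def] w_C[OF r, symmetric] w_def
    using y(1)[OF I_sub[OF r]] bessel_J0_deriv[of r] bessel_J0_pos[of r] r
    by (auto intro!: derivative_eq_intros simp: field_simps power2_eq_square)
  have y_zero_iff: "y r = 0 \<longleftrightarrow> u r = 0" if "0 < r" "r < bessel_z0" for r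
    using bessel_J0_pos[of r] that by (auto simp: u_def)
  consider "C = 0" | "0 < C" | "0 < - C" by linarith
  then show ?thesis
  proof cases
    case 1
    define c where "c = u m"
    have u_c: "u r = c" if "0 < r" "r < bessel_z0" for r
    proof -
      have "\<exists>c. \<forall>x\<in>{0<..<bessel_z0}. u x = c"
        using u_deriv 1
        by (intro has_field_derivative_zero_constant) (auto intro: has_field_derivative_at_within)
      with that m show ?thesis by (auto simp: c_def)
    qed
    have y_c: "y r = c * bessel_J0 r" if "0 < r" "r < bessel_z0" for r
      using u_c[OF that] bessel_J0_pos[of r] that by (simp add: u_def field_simps)
    have "y r = c * bessel_J0 r" if r: "r \<in> I" for r
    proof (cases "m \<le> r")
      case True
      \<comment> \<open>The quotient is only available up to z_0. Beyond it, proportionality is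
        propagated from \<open>m\<close>, where the difference and its derivative both
        vanish.\<close>
      have "y r - c * bessel_J0 r = 0"
      proof (rule bessel_solution_zero_forward[where a = m and b = r
            and y = "\<lambda>r. y r - c * bessel_J0 r" and y' = "\<lambda>r. y' r - c * bessel_J0' r"])
        fix x assume x: "m \<le> x" "x \<le> r"
        then have xI: "x \<in> I" using I_conv[OF r m(1)] by auto
        show "((\<lambda>r. y r - c * bessel_J0 r) has_real_derivative y' x - c * bessel_J0' x) (at x)"
          using y(1)[OF xI] bessel_J0_deriv[of x] by (auto intro!: derivative_eq_intros)
        show "((\<lambda>r. y' r - c * bessel_J0' r) has_real_derivative
            - (y' x - c * bessel_J0' x) / x - (y x - c * bessel_J0 x)) (at x)"
          using y'_deriv[OF xI] bessel_J0'_deriv[of x] I_pos[OF xI]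
          by (auto intro!: derivative_eq_intros simp: field_simps)
      next
        show "y m - c * bessel_J0 m = 0" using y_c[OF m] by simp
        have "bessel_J0 m * y' m = bessel_J0' m * y m"
          using 1 m by (simp add: C_def w_def)
        then show "y' m - c * bessel_J0' m = 0"
          using y_c[OF m] bessel_J0_pos[of m] m by simp
      qed (use m True in auto)
      then show ?thesis by simp
    next
      case False
      then show ?thesis using y_c[of r] I_pos[OF r] m by auto
    qed
    with nprop show ?thesis by blast
  next
    case 2
    from zero_of_increasing_quotient[OF 2 u_deriv] show ?thesis
      using y_zero_iff by fastforce
  next
    \<comment> \<open>The quotient of - y has the positive constant - C and the same zeros.\<close>
    case 3
    have "((\<lambda>r. - u r) has_real_derivative - C / (r * (bessel_J0 r)\<^sup>2)) (at r)"
      if "0 < r" "r < bessel_z0" for r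
      using DERIV_minus[OF u_deriv[OF that]] by simp
    from zero_of_increasing_quotient[OF 3 this] show ?thesis
      using y_zero_iff by fastforce
  qed
qed

text \<open>Multiples of J_0 vanish at z_0, which now lies inside the interval; all other solutions
  vanish even earlier.\<close>

lemma no_positive_solution_beyond_z0:
  assumes "bessel_z0 < R"
  shows "\<not> positive_bessel_solution {0<..<R} (\<lambda>r. 1) y"
proof
  assume pos: "positive_bessel_solution {0<..<R} (\<lambda>r. 1) y"
  then have y: "bessel_solution {0<..<R} (\<lambda>r. 1) y" "\<And>r. 0 < r \<Longrightarrow> r < R \<Longrightarrow> 0 < y r"
    by (auto simp: positive_bessel_solution_def)
  show False
  proof (cases "\<exists>c. \<forall>r\<in>{0<..<R}. y r = c * bessel_J0 r")
    case True
    then show ?thesis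
      using y(2)[of bessel_z0] assms bessel_z0_pos by (auto simp: bessel_z0_props)
  next
    case False
    with first_zero_less_bessel_z0[OF _ y(1)] assms obtain x where "0 < x" "x < bessel_z0" "y x = 0"
      using less_imp_le by blast
    then show ?thesis using y(2)[of x] assms by simp
  qed
qed

section \<open>Constant, power and zero potentials\<close>

lemma positive_bessel_solution_scale:
  assumes pos: "positive_bessel_solution {0<..<R} (\<lambda>r. c) y" and q: "0 < q"
  shows "positive_bessel_solution {0<..<R / q} (\<lambda>r. c * q\<^sup>2) (\<lambda>r. y (q * r))"
proof -
  obtain y' y'' where y: "\<And>r. r \<in> {0<..<R} \<Longrightarrow> (y has_real_derivative y' r) (at r)"
    "\<And>r. r \<in> {0<..<R} \<Longrightarrow> (y' has_real_derivative y'' r) (at r)"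
    "\<And>r. r \<in> {0<..<R} \<Longrightarrow> y'' r + 1 / r * y' r + c * y r = 0"
    "\<And>r. r \<in> {0<..<R} \<Longrightarrow> 0 < y r"
    using pos unfolding positive_bessel_solution_def bessel_solution_def by metis
  have lin: "((*) q has_real_derivative q) (at r)" for r
    by (auto intro!: derivative_eq_intros)
  have q_in: "q * r \<in> {0<..<R}" if "r \<in> {0<..<R / q}" for r
    using that q by (simp add: field_simps)
  show ?thesis
    unfolding positive_bessel_solution_def bessel_solution_def
  proof (intro conjI exI ballI)
    fix r assume r: "r \<in> {0<..<R / q}"
    note qr = q_in[OF r]
    show "((\<lambda>r. y (q * r)) has_real_derivative y' (q * r) * q) (at r)"
      by (rule DERIV_chain2[OF y(1)[OF qr] lin])
    show "((\<lambda>r. y' (q * r) * q) has_real_derivative y'' (q * r) * q * q) (at r)"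
      by (rule DERIV_cmult_right[OF DERIV_chain2[OF y(2)[OF qr] lin]])
    have "y'' (q * r) * q * q + 1 / r * (y' (q * r) * q) + c * q\<^sup>2 * y (q * r) =
        q\<^sup>2 * (y'' (q * r) + 1 / (q * r) * y' (q * r) + c * y (q * r))"
      using q r by (simp add: field_simps power2_eq_square)
    then show "y'' (q * r) * q * q + 1 / r * (y' (q * r) * q) + c * q\<^sup>2 * y (q * r) = 0"
      using y(3)[OF qr] by simp
    show "0 < y (q * r)" by (rule y(4)[OF qr])
  qed
qed

text \<open>Scaling by z_0 / R moves J_0 to (0, R). Conversely, a positive solution for a larger c,
  scaled by 1 / sqrt c, would solve (B_1) on an interval reaching beyond z_0.\<close>

lemma constant_potential:
  assumes "0 < R"
  shows "bessel_potential (\<lambda>r. 1) R" "bessel_weight (\<lambda>r. 1) R = ereal (bessel_z0\<^sup>2 / R\<^sup>2)"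
proof -
  let ?q = "bessel_z0 / R"
  have q: "0 < ?q" using assms bessel_z0_pos by simp
  have sol: "positive_bessel_solution {0<..<R} (\<lambda>r. bessel_z0\<^sup>2 / R\<^sup>2 * 1) (\<lambda>r. bessel_J0 (?q * r))"
    using positive_bessel_solution_scale[OF positive_solution_J0 q] bessel_z0_pos
    by (simp add: power_divide)
  have pos: "0 < bessel_z0\<^sup>2 / R\<^sup>2" using assms bessel_z0_pos by simp
  show "bessel_potential (\<lambda>r. 1) R"
    unfolding bessel_potential_def using pos sol by auto
  show "bessel_weight (\<lambda>r. 1) R = ereal (bessel_z0\<^sup>2 / R\<^sup>2)"
  proof (rule bessel_weight_eqI[OF pos sol])
    fix c y assume c: "bessel_z0\<^sup>2 / R\<^sup>2 < c"
    then have "0 < c" using pos by linarith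
    show "\<not> positive_bessel_solution {0<..<R} (\<lambda>r. c * 1) y"
    proof
      assume "positive_bessel_solution {0<..<R} (\<lambda>r. c * 1) y"
      then have "positive_bessel_solution {0<..<R / inverse (sqrt c)} (\<lambda>r. c * 1 * (inverse (sqrt c))\<^sup>2)
          (\<lambda>r. y (inverse (sqrt c) * r))"
        by (rule positive_bessel_solution_scale) (use \<open>0 < c\<close> in simp)
      moreover have "c * 1 * (inverse (sqrt c))\<^sup>2 = 1"
        using \<open>0 < c\<close> by (simp add: power_inverse)
      moreover have "?q < sqrt c"
        using c by (intro real_less_rsqrt) (simp add: power_divide)
      then have "bessel_z0 < R / inverse (sqrt c)"
        using assms by (simp add: field_simps)
      ultimately show False using no_positive_solution_beyond_z0 by simp
    qed
  qed
qed

text \<open>For \<open>m = (2 - a) / 2\<close> the function \<open>r \<mapsto> J\<^sub>0 (r\<^sup>m / m)\<close> solves the equation with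
  potential \<open>r\<^sup>-\<^sup>a\<close>.\<close>

lemma power_potential:
  fixes a :: real
  assumes "a < 2"
  shows "\<exists>R>0. bessel_potential (\<lambda>r. r powr (- a)) R"
proof -
  define m where "m = (2 - a) / 2"
  have m: "0 < m" using assms by (simp add: m_def)
  \<comment> \<open>Chosen so that R^m / m = z_0: the substitution then maps (0, R) into the
    interval where J_0 is positive.\<close>
  define R where "R = (m * bessel_z0) powr (1 / m)"
  have R: "0 < R" using m bessel_z0_pos by (simp add: R_def)
  define f where "f r = r powr m / m" for r :: real
  have f_deriv: "(f has_real_derivative r powr (m - 1)) (at r)" if "0 < r" for r
    unfolding f_def[abs_def] using that m by (auto intro!: derivative_eq_intros)
  have f_range: "0 < f r" "f r < bessel_z0" if "r \<in> {0<..<R}" for r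
  proof -
    have "r powr m < R powr m" using that m by (intro powr_less_mono2) auto
    also have "R powr m = m * bessel_z0" using m bessel_z0_pos by (simp add: R_def powr_powr)
    finally show "f r < bessel_z0" using m by (simp add: f_def field_simps)
  qed (use that m in \<open>simp add: f_def\<close>)
  have "positive_bessel_solution {0<..<R} (\<lambda>r. 1 * r powr (- a)) (\<lambda>r. bessel_J0 (f r))"
    unfolding positive_bessel_solution_def bessel_solution_def
  proof (intro conjI exI ballI)
    fix r assume rR: "r \<in> {0<..<R}"
    then have r: "0 < r" by simp
    note fr = f_range[OF rR]
    define p where "p = r powr (m - 1)"
    show "((\<lambda>r. bessel_J0 (f r)) has_real_derivative bessel_J0' (f r) * r powr (m - 1)) (at r)"
      by (rule DERIV_chain2[OF bessel_J0_deriv f_deriv[OF r]])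
    have "((\<lambda>r. bessel_J0' (f r)) has_real_derivative
        (- bessel_J0' (f r) / f r - bessel_J0 (f r)) * p) (at r)"
      unfolding p_def
      by (rule DERIV_chain2[OF bessel_J0'_deriv f_deriv[OF r]]) (use fr in simp)
    moreover have "((\<lambda>r. r powr (m - 1)) has_real_derivative (m - 1) * p / r) (at r)"
    proof -
      have "(m - 1) * r powr (m - 1 - 1) = (m - 1) * p / r"
        using r by (simp add: p_def powr_diff power2_eq_square)
      with has_real_derivative_powr[OF r, of "m - 1"] show ?thesis by (simp only:)
    qed
    ultimately show "((\<lambda>r. bessel_J0' (f r) * r powr (m - 1)) has_real_derivative
        (- bessel_J0' (f r) / f r - bessel_J0 (f r)) * p * p + (m - 1) * p / r * bessel_J0' (f r)) (at r)"
      unfolding p_def by (rule DERIV_mult)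
    have f_p: "f r = r * p / m" using r by (simp add: f_def p_def powr_diff)
    \<comment> \<open>This fixes the choice of \<open>m\<close>: 2 (m - 1) = - a.\<close>
    have pp: "p * p = r powr (- a)"
      unfolding p_def powr_add[symmetric] by (simp add: m_def)
    have "0 < p" using r by (simp add: p_def)
    have "(- bessel_J0' (f r) / f r - bessel_J0 (f r)) * p * p + (m - 1) * p / r * bessel_J0' (f r)
        + 1 / r * (bessel_J0' (f r) * p) + 1 * (p * p) * bessel_J0 (f r) =
        bessel_J0' (f r) * (- p * p / f r + m * p / r)"
      by (simp add: algebra_simps add_divide_distrib diff_divide_distrib)
    also have "- p * p / f r + m * p / r = 0"
      unfolding f_p using \<open>0 < p\<close> r m by (simp add: field_simps)
    finally show "(- bessel_J0' (f r) / f r - bessel_J0 (f r)) * p * p + (m - 1) * p / r * bessel_J0' (f r)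
        + 1 / r * (bessel_J0' (f r) * r powr (m - 1)) + 1 * r powr (- a) * bessel_J0 (f r) = 0"
      unfolding pp[symmetric] p_def by simp
    show "0 < bessel_J0 (f r)" using bessel_J0_pos fr by simp
  qed
  moreover have "(\<lambda>r. r powr (- a)) C1_differentiable_on {0<..<R}"
    unfolding C1_differentiable_on_def has_real_derivative_iff_has_vector_derivative[symmetric]
    by (intro exI[of _ "\<lambda>r. - a * r powr (- a - 1)"])
      (auto intro!: derivative_eq_intros continuous_intros)
  ultimately have "bessel_potential (\<lambda>r. r powr (- a)) R"
    unfolding bessel_potential_def by (metis zero_less_one powr_ge_zero)
  with R show ?thesis by blast
qed

lemma zero_potential: "bessel_potential (\<lambda>r. 0) R"
proof -
  have "positive_bessel_solution {0<..<R} (\<lambda>r. 1 * 0) (\<lambda>r. 1)"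
    unfolding positive_bessel_solution_def bessel_solution_def
    by (intro conjI exI[of _ "\<lambda>r. 0"]) auto
  then show ?thesis
    unfolding bessel_potential_def by (metis C1_differentiable_on_const order_refl zero_less_one)
qed

section \<open>Iterated logarithms\<close>

text \<open>Positivity up to level \<open>k\<close> makes the products positive and lets
  \<open>L (Suc k)\<close> be differentiated. The two families are the instances s = 0 and s =
  1.\<close>

locale log_chain =
  fixes s \<rho> R :: real and k :: nat
  assumes \<rho>_pos: "0 < \<rho>" and R_pos: "0 < R"
    and chain_pos: "\<And>i r. \<lbrakk>1 \<le> i; i \<le> k; 0 < r; r < R\<rbrakk> \<Longrightarrow> 0 < ((\<lambda>x. s + ln x) ^^ i) (\<rho> / r)"
begin

definition L :: "nat \<Rightarrow> real \<Rightarrow> real" where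
  "L i r = ((\<lambda>x. s + ln x) ^^ i) (\<rho> / r)"

definition P :: "nat \<Rightarrow> real \<Rightarrow> real" where
  "P j r = (\<Prod>i=1..j. L i r)"

text \<open>- S_j / r is the logarithmic derivative of P_j.\<close>

definition S :: "nat \<Rightarrow> real \<Rightarrow> real" where
  "S j r = (\<Sum>i=1..j. 1 / P i r)"

definition U :: "nat \<Rightarrow> real \<Rightarrow> real" where
  "U j r = 1 / r\<^sup>2 * (1 / P j r)\<^sup>2"

definition W :: "real \<Rightarrow> real" where
  "W r = (\<Sum>j=1..k. U j r)"

definition \<phi> :: "real \<Rightarrow> real" where
  "\<phi> r = sqrt (P k r)"

section \<open>Derivatives of the chain and of its products\<close>

lemma L_pos: "i \<le> k \<Longrightarrow> 0 < r \<Longrightarrow> r < R \<Longrightarrow> 0 < L i r"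
  using chain_pos[of i r] \<rho>_pos by (cases i) (auto simp: L_def)

lemma P_pos: "j \<le> k \<Longrightarrow> 0 < r \<Longrightarrow> r < R \<Longrightarrow> 0 < P j r"
  unfolding P_def by (rule prod_pos) (auto intro: L_pos)

lemma P_Suc: "P (Suc j) r = P j r * L (Suc j) r"
  by (simp add: P_def)

lemma L_deriv:
  "i \<le> k \<Longrightarrow> 0 < r \<Longrightarrow> r < R \<Longrightarrow> (L (Suc i) has_real_derivative - 1 / (r * P i r)) (at r)"
proof (induction i)
  case 0
  have "((\<lambda>r. s + ln (\<rho> / r)) has_real_derivative - 1 / r) (at r)"
    using 0 \<rho>_pos by (auto intro!: derivative_eq_intros simp: field_simps)
  then show ?case by (simp add: L_def[abs_def] P_def)
next
  case (Suc i)
  have pos: "0 < L (Suc i) r" using Suc.prems by (intro L_pos) auto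
  have "(L (Suc i) has_real_derivative - 1 / (r * P i r)) (at r)"
    using Suc by simp
  then have "((\<lambda>r. s + ln (L (Suc i) r)) has_real_derivative - 1 / (r * P i r) / L (Suc i) r) (at r)"
    using pos by (auto intro!: derivative_eq_intros)
  moreover have "(\<lambda>r. s + ln (L (Suc i) r)) = L (Suc (Suc i))"
    by (simp add: L_def[abs_def])
  ultimately show ?case by (simp add: P_Suc mult.assoc)
qed

text \<open>The new factor contributes P_j L_(j+1)' = - 1 / r, which is the summand 1 / P_(j+1)
  added to S, multiplied by - P_(j+1) / r.\<close>

lemma P_deriv:
  "j \<le> k \<Longrightarrow> 0 < r \<Longrightarrow> r < R \<Longrightarrow> (P j has_real_derivative - P j r * S j r / r) (at r)"
proof (induction j)
  case 0
  then show ?case by (simp add: P_def[abs_def] S_def)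
next
  case (Suc j)
  have pos: "0 < P j r" "0 < L (Suc j) r"
    using Suc.prems by (auto intro: P_pos L_pos)
  have "(P j has_real_derivative - P j r * S j r / r) (at r)"
       "(L (Suc j) has_real_derivative - 1 / (r * P j r)) (at r)"
    using Suc L_deriv[of j r] by auto
  then have "((\<lambda>r. P j r * L (Suc j) r) has_real_derivative
      - P j r * S j r / r * L (Suc j) r + (- 1 / (r * P j r)) * P j r) (at r)"
    by (rule DERIV_mult)
  moreover have "- P j r * S j r / r * L (Suc j) r + (- 1 / (r * P j r)) * P j r =
      - P (Suc j) r * S (Suc j) r / r"
    using pos Suc.prems by (simp add: P_Suc S_def field_simps)
  ultimately show ?case by (simp add: P_Suc[abs_def])
qed

lemma inverse_P_deriv:
  assumes "j \<le> k" "0 < r" "r < R"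
  shows "((\<lambda>r. 1 / P j r) has_real_derivative S j r / P j r / r) (at r)"
  using P_deriv[OF assms] P_pos[OF assms]
  by (auto intro!: derivative_eq_intros simp: field_simps power2_eq_square)

lemma S_deriv:
  assumes "j \<le> k" "0 < r" "r < R"
  shows "(S j has_real_derivative (\<Sum>i=1..j. S i r / P i r / r)) (at r)"
proof -
  have "((\<lambda>r. \<Sum>i=1..j. 1 / P i r) has_real_derivative (\<Sum>i=1..j. S i r / P i r / r)) (at r)"
    using assms by (intro DERIV_sum inverse_P_deriv) auto
  then show ?thesis by (simp only: S_def[abs_def])
qed

text \<open>Summation of S_i^2 - S_(i-1)^2 = 2 S_i / P_i - 1 / P_i^2. The sum of the 1 / P_i^2 is
  r^2 W when j = k.\<close>

lemma S_square: "(S j r)\<^sup>2 + (\<Sum>i=1..j. (1 / P i r)\<^sup>2) = 2 * (\<Sum>i=1..j. S i r / P i r)"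
proof (induction j)
  case (Suc j)
  have "S (Suc j) r = S j r + 1 / P (Suc j) r" by (simp add: S_def)
  then show ?case using Suc
    by (simp add: power2_eq_square algebra_simps add_divide_distrib)
qed (simp add: S_def)

section \<open>The square root of the product solves the critical equation\<close>

lemma \<phi>_pos: "0 < r \<Longrightarrow> r < R \<Longrightarrow> 0 < \<phi> r"
  using P_pos[of k r] by (simp add: \<phi>_def)

lemma \<phi>_square: "0 < r \<Longrightarrow> r < R \<Longrightarrow> \<phi> r * \<phi> r = P k r"
  using P_pos[of k r] by (simp add: \<phi>_def)

lemma \<phi>_deriv:
  assumes "0 < r" "r < R"
  shows "(\<phi> has_real_derivative - \<phi> r * S k r / (2 * r)) (at r)"
proof -
  have "((\<lambda>r. sqrt (P k r)) has_real_derivative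
      inverse (sqrt (P k r)) / 2 * (- P k r * S k r / r)) (at r)"
    using P_deriv[of k r] P_pos[of k r] assms by (intro DERIV_chain2[OF DERIV_real_sqrt]) auto
  moreover have "inverse (sqrt (P k r)) / 2 * (- P k r * S k r / r) = - \<phi> r * S k r / (2 * r)"
    using \<phi>_pos[OF assms] assms unfolding \<phi>_square[OF assms, symmetric]
    by (simp add: field_simps \<phi>_def mult_ac)
  ultimately show ?thesis by (simp only: \<phi>_def[abs_def])
qed

text \<open>Differentiation produces S^2 and the sum D = r S'. Replacing D by means of
  \<open>S_square\<close> cancels S^2, and what remains of order zero is exactly - W / 4.\<close>

lemma \<phi>_deriv2:
  assumes "0 < r" "r < R"
  shows "((\<lambda>r. - \<phi> r * S k r / (2 * r)) has_real_derivative
           \<phi> r * S k r / (2 * r\<^sup>2) - 1/4 * W r * \<phi> r) (at r)"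
proof -
  define D where "D = (\<Sum>i=1..k. S i r / P i r)"
  define Q where "Q = (\<Sum>i=1..k. (1 / P i r)\<^sup>2)"
  have "(S k has_real_derivative D / r) (at r)"
    using S_deriv[of k r] assms by (simp add: D_def sum_divide_distrib)
  then have *: "((\<lambda>r. - \<phi> r * S k r / (2 * r)) has_real_derivative
      ((\<phi> r * S k r / (2 * r) * S k r - \<phi> r * (D / r)) * (2 * r) + \<phi> r * S k r * 2) / (2 * r)\<^sup>2) (at r)"
    using \<phi>_deriv[OF assms] assms
    by (auto intro!: derivative_eq_intros simp: power2_eq_square field_simps)
  have WQ: "W r = Q / r\<^sup>2"
    by (simp add: W_def U_def Q_def sum_divide_distrib)
  have D: "D = ((S k r)\<^sup>2 + Q) / 2"
    using S_square[of k r] by (simp add: D_def Q_def)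
  have "((\<phi> r * S k r / (2 * r) * S k r - \<phi> r * (D / r)) * (2 * r) + \<phi> r * S k r * 2) / (2 * r)\<^sup>2 =
      \<phi> r * S k r / (2 * r\<^sup>2) - 1/4 * W r * \<phi> r"
    unfolding WQ D using assms by (simp add: field_simps power2_eq_square)
  with * show ?thesis by simp
qed

lemma positive_solution_\<phi>: "positive_bessel_solution {0<..<R} (\<lambda>r. 1/4 * W r) \<phi>"
  unfolding positive_bessel_solution_def bessel_solution_def
proof (intro conjI exI ballI)
  fix r assume r: "r \<in> {0<..<R}"
  show "(\<phi> has_real_derivative - \<phi> r * S k r / (2 * r)) (at r)"
    "((\<lambda>r. - \<phi> r * S k r / (2 * r)) has_real_derivative
      \<phi> r * S k r / (2 * r\<^sup>2) - 1/4 * W r * \<phi> r) (at r)"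
    "0 < \<phi> r"
    using r by (simp_all only: \<phi>_deriv \<phi>_deriv2 \<phi>_pos greaterThanLessThan_iff)
  show "\<phi> r * S k r / (2 * r\<^sup>2) - 1/4 * W r * \<phi> r + 1 / r * (- \<phi> r * S k r / (2 * r))
      + 1/4 * W r * \<phi> r = 0"
    by (simp add: power2_eq_square)
qed

section \<open>Nonnegativity and regularity of the potential\<close>

lemma U_nonneg: "0 \<le> U j r"
  by (simp add: U_def)

lemma W_ge_U: "1 \<le> k \<Longrightarrow> U k r \<le> W r"
  unfolding W_def by (rule member_le_sum) (auto simp: U_nonneg)

lemma U_C1:
  assumes "j \<le> k"
  shows "U j C1_differentiable_on {0<..<R}"
proof -
  \<comment> \<open>\<open>U j\<close> is the square of 1 / (r P_j), whose derivative is (S_j / P_j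
    - 1 / P_j) / r^2.\<close>
  define D where "D r = 2 * ((S j r / P j r - 1 / P j r) / (r * r) * (1 / P j r / r))" for r
  have "(U j has_real_derivative D r) (at r)" if "r \<in> {0<..<R}" for r
  proof -
    have "((\<lambda>r. 1 / P j r / r) has_real_derivative
        ((S j r / P j r / r) * r - 1 / P j r * 1) / (r * r)) (at r)"
      using that assms by (intro DERIV_divide inverse_P_deriv DERIV_ident) auto
    from DERIV_power[OF this, of 2] show ?thesis
      using that by (simp add: D_def U_def[abs_def] power_divide power_mult_distrib mult.commute)
  qed
  moreover have "continuous_on {0<..<R} D"
  proof -
    have "continuous_on {0<..<R} (P j)" "continuous_on {0<..<R} (S j)"
      using P_deriv S_deriv assms
      by (auto intro!: continuous_at_imp_continuous_on DERIV_isCont)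
    moreover have "P j r \<noteq> 0" if "0 < r" "r < R" for r
      using P_pos[of j r] assms that by simp
    ultimately show ?thesis
      unfolding D_def[abs_def] by (auto intro!: continuous_intros)
  qed
  ultimately show ?thesis
    unfolding C1_differentiable_on_def has_real_derivative_iff_has_vector_derivative by blast
qed

lemma bessel_potential_W: "bessel_potential W R"
proof -
  have "W C1_differentiable_on {0<..<R}"
  proof -
    have "(\<lambda>r. \<Sum>j=1..n. U j r) C1_differentiable_on {0<..<R}" if "n \<le> k" for n
      using that by (induction n) (auto simp: U_C1)
    then show ?thesis by (simp add: W_def[abs_def])
  qed
  moreover have "0 \<le> W r" for r
    unfolding W_def by (intro sum_nonneg U_nonneg)
  ultimately show ?thesis
    unfolding bessel_potential_def
    by (intro conjI ballI exI[of _ "1/4"] exI[of _ \<phi>] positive_solution_\<phi>) auto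
qed

section \<open>Oscillation under perturbation, and the weight\<close>

lemma L_at_top: "filterlim (L i) at_top (at_right 0)"
proof (induction i)
  case 0
  have "filterlim (\<lambda>r. \<rho> * inverse r) at_top (at_right (0::real))"
    by (rule filterlim_tendsto_pos_mult_at_top[OF tendsto_const \<rho>_pos filterlim_inverse_at_top_right])
  then show ?case by (simp add: L_def[abs_def] divide_inverse)
next
  case (Suc i)
  have "filterlim (\<lambda>r. s + ln (L i r)) at_top (at_right 0)"
    by (intro filterlim_tendsto_add_at_top[OF tendsto_const] filterlim_compose[OF ln_at_top Suc])
  then show ?case by (simp add: L_def[abs_def])
qed

lemma L_exceeds:
  assumes "0 < b"
  shows "\<exists>r. 0 < r \<and> r < b \<and> c < L i r"
proof -
  have "\<forall>\<^sub>F r in at_right 0. c < L i r"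
    using L_at_top[of i] by (simp add: filterlim_at_top_dense)
  moreover have "\<forall>\<^sub>F r in at_right 0. r \<in> {0<..<b}"
    using eventually_at_right_real[OF assms] .
  ultimately have "\<forall>\<^sub>F r in at_right 0. 0 < r \<and> r < b \<and> c < L i r"
    by eventually_elim auto
  then show ?thesis
    by (rule eventually_happens'[OF trivial_limit_at_right_real])
qed

text \<open>With \<open>u = y / \<phi>\<close> and the variable \<open>\<theta> = L (k + 1)\<close>, which tends to infinity at \<open>0\<close>, the equation
  becomes \<open>d\<^sup>2u/d\<theta>\<^sup>2 \<le> - \<lambda> u\<close>; the function \<open>q\<close> below is \<open>du/d\<theta>\<close>. A positive \<open>u\<close> would be concave
  on a half-line, hence nondecreasing in \<open>\<theta>\<close>, and then \<open>du/d\<theta>\<close> would tend to minus infinity.\<close>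

lemma no_positive_solution:
  assumes lam: "0 < lam"
    and V: "\<And>r. 0 < r \<Longrightarrow> r < R \<Longrightarrow> 1/4 * W r + lam * U k r \<le> V r"
  shows "\<not> positive_bessel_solution {0<..<R} V y"
proof
  assume "positive_bessel_solution {0<..<R} V y"
  then obtain y' y'' where sol: "\<forall>r\<in>{0<..<R}. (y has_real_derivative y' r) (at r) \<and>
      (y' has_real_derivative y'' r) (at r) \<and> y'' r + 1 / r * y' r + V r * y r = 0"
    and y_pos: "\<And>r. 0 < r \<Longrightarrow> r < R \<Longrightarrow> 0 < y r"
    unfolding positive_bessel_solution_def bessel_solution_def by auto
  have y: "(y has_real_derivative y' r) (at r)" "(y' has_real_derivative y'' r) (at r)"
    "y'' r + 1 / r * y' r + V r * y r = 0" if "0 < r" "r < R" for r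
    using sol that by (simp_all only: greaterThanLessThan_iff)
  define f' where "f' r = - \<phi> r * S k r / (2 * r)" for r
  define \<theta> where "\<theta> = L (Suc k)"
  define u where "u r = y r / \<phi> r" for r
  \<comment> \<open>r times a Wronskian of y and \<phi>: it is the quotient of u' by \<theta>' = - 1
    / (r P_k).\<close>
  define q where "q r = r * (y r * f' r - y' r * \<phi> r)" for r
  define q' where "q' r = r * (V r - 1/4 * W r) * y r * \<phi> r" for r
  have \<theta>': "(\<theta> has_real_derivative - 1 / (r * P k r)) (at r)" if "0 < r" "r < R" for r
    unfolding \<theta>_def using L_deriv that by auto
  have u': "(u has_real_derivative - q r / (r * P k r)) (at r)" if r: "0 < r" "r < R" for r
    unfolding u_def[abs_def] q_def f'_def \<phi>_square[OF r, symmetric]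
    using y(1)[OF r] \<phi>_deriv[OF r] \<phi>_pos[OF r] r
    by (auto intro!: derivative_eq_intros simp: field_simps)
  have u_pos: "0 < u r" if "0 < r" "r < R" for r
    using y_pos \<phi>_pos that by (simp add: u_def)
  have q': "(q has_real_derivative q' r) (at r)" if r: "0 < r" "r < R" for r
  proof -
    define f'' where "f'' = \<phi> r * S k r / (2 * r\<^sup>2) - 1/4 * W r * \<phi> r"
    have "(\<phi> has_real_derivative f' r) (at r)" "(f' has_real_derivative f'') (at r)"
      using \<phi>_deriv[OF r] \<phi>_deriv2[OF r] by (simp_all add: f'_def[abs_def] f''_def)
    then have "(q has_real_derivative
        (y r * f' r - y' r * \<phi> r) + r * (y r * f'' - y'' r * \<phi> r)) (at r)"
      unfolding q_def[abs_def] using y(1,2)[OF r]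
      by (auto intro!: derivative_eq_intros simp: algebra_simps)
    moreover have f'': "f'' = - 1/4 * W r * \<phi> r - 1 / r * f' r"
      unfolding f''_def f'_def using r by (simp add: power2_eq_square)
    moreover have y'': "y'' r = - 1 / r * y' r - V r * y r" using y(3)[OF r] by simp
    have "(y r * f' r - y' r * \<phi> r) + r * (y r * f'' - y'' r * \<phi> r) = q' r"
      unfolding f'' y'' q'_def using r by (simp add: field_simps)
    ultimately show ?thesis by simp
  qed
  \<comment> \<open>In the variable \<theta> this reads dq/d\<theta> \<le> - lam u; the sign changes
    because \<theta> decreases in r.\<close>
  have q'_ge: "lam * u r / (r * P k r) \<le> q' r" if r: "0 < r" "r < R" for r
  proof -
    have "lam * u r / (r * P k r) = r * (lam * U k r) * y r * \<phi> r"
      unfolding U_def u_def \<phi>_square[OF r, symmetric] using \<phi>_pos[OF r] r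
      by (simp add: field_simps power2_eq_square)
    also have "\<dots> \<le> q' r"
      unfolding q'_def using V[OF r] r y_pos[OF r] \<phi>_pos[OF r]
      by (intro mult_right_mono mult_left_mono) auto
    finally show ?thesis .
  qed
  have q_mono: "q r \<le> q t" if "0 < r" "r \<le> t" "t < R" for r t
  proof (rule DERIV_nonneg_imp_nondecreasing[OF that(2)])
    fix x assume x: "r \<le> x" "x \<le> t"
    have "0 \<le> lam * u x / (x * P k x)"
      using lam u_pos[of x] P_pos[of k x] x that by (intro divide_nonneg_nonneg mult_nonneg_nonneg) auto
    then show "\<exists>D. (q has_real_derivative D) (at x) \<and> 0 \<le> D"
      using q'[of x] q'_ge[of x] x that by force
  qed
  have q_nonneg: "0 \<le> q t" if t: "0 < t" "t < R" for t
  proof (rule ccontr)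
    assume neg: "\<not> 0 \<le> q t"
    \<comment> \<open>By concavity u lies below its tangent at \<open>t\<close>, seen as a function
      of \<theta>. A negative slope \<open>q t\<close> would force u below 0, as \<theta> is
      unbounded near 0.\<close>
    have "u r - q t * \<theta> r \<le> u t - q t * \<theta> t" if "0 < r" "r \<le> t" for r
    proof (rule DERIV_nonneg_imp_nondecreasing[OF that(2)])
      fix x assume x: "r \<le> x" "x \<le> t"
      have "((\<lambda>r. u r - q t * \<theta> r) has_real_derivative (q t - q x) / (x * P k x)) (at x)"
        using u'[of x] \<theta>'[of x] x t that
        by (auto intro!: derivative_eq_intros simp: diff_divide_distrib)
      moreover have "0 \<le> (q t - q x) / (x * P k x)"
        using q_mono[of x t] P_pos[of k x] x t that by (intro divide_nonneg_nonneg) auto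
      ultimately show "\<exists>D. ((\<lambda>r. u r - q t * \<theta> r) has_real_derivative D) (at x) \<and> 0 \<le> D" by blast
    qed
    moreover obtain r where r: "0 < r" "r < t" "(u t - q t * \<theta> t) / (- q t) < \<theta> r"
      using L_exceeds[OF t(1)] unfolding \<theta>_def by blast
    ultimately have "u r - q t * \<theta> r \<le> u t - q t * \<theta> t" by simp
    moreover have "u t - q t * \<theta> t < - q t * \<theta> r"
      using r(3) neg by (simp add: field_simps)
    ultimately show False using u_pos[of r] r t by simp
  qed
  define t where "t = R / 2"
  have t: "0 < t" "t < R" using R_pos by (auto simp: t_def)
  have u_anti: "u t \<le> u r" if "0 < r" "r \<le> t" for r
  proof (rule DERIV_nonpos_imp_nonincreasing[OF that(2)])
    fix x assume x: "r \<le> x" "x \<le> t"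
    have "- q x / (x * P k x) \<le> 0"
      using q_nonneg[of x] P_pos[of k x] x t that by (intro divide_nonpos_nonneg) auto
    then show "\<exists>D. (u has_real_derivative D) (at x) \<and> D \<le> 0"
      using u'[of x] x t that by force
  qed
  \<comment> \<open>As u stays above \<open>u t\<close>, q decreases at least linearly in \<theta>,
    and so becomes negative near r = 0.\<close>
  have "q r + lam * u t * \<theta> r \<le> q t + lam * u t * \<theta> t" if "0 < r" "r \<le> t" for r
  proof (rule DERIV_nonneg_imp_nondecreasing[OF that(2)])
    fix x assume x: "r \<le> x" "x \<le> t"
    have "((\<lambda>r. q r + lam * u t * \<theta> r) has_real_derivative q' x - lam * u t / (x * P k x)) (at x)"
      using q'[of x] \<theta>'[of x] x t that
      by (auto intro!: derivative_eq_intros)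
    moreover have "lam * u t / (x * P k x) \<le> lam * u x / (x * P k x)"
      using u_anti[of x] lam P_pos[of k x] x t that by (intro divide_right_mono mult_left_mono) auto
    then have "0 \<le> q' x - lam * u t / (x * P k x)"
      using q'_ge[of x] x t that by simp
    ultimately show "\<exists>D. ((\<lambda>r. q r + lam * u t * \<theta> r) has_real_derivative D) (at x) \<and> 0 \<le> D" by blast
  qed
  moreover have lu: "0 < lam * u t" using lam u_pos t by simp
  moreover obtain r where r: "0 < r" "r < t" "(q t + lam * u t * \<theta> t) / (lam * u t) < \<theta> r"
    using L_exceeds[OF t(1)] unfolding \<theta>_def by blast
  ultimately have "q r + lam * u t * \<theta> r \<le> q t + lam * u t * \<theta> t" by simp
  moreover have "q t + lam * u t * \<theta> t < lam * u t * \<theta> r"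
    using r(3) lu by (simp add: field_simps)
  ultimately show False using q_nonneg[of r] r t by simp
qed

end

text \<open>For c > 1/4 the surplus (c - 1/4) W dominates (c - 1/4) U_k, so
  \<open>no_positive_solution\<close> applies to c W.\<close>

lemma (in log_chain) bessel_weight_W:
  assumes "1 \<le> k"
  shows "bessel_weight W R = ereal (1/4)"
proof (rule bessel_weight_eqI[OF _ positive_solution_\<phi>])
  fix c y assume "1/4 < (c::real)"
  have "(c - 1/4) * U k r \<le> (c - 1/4) * W r" for r
    using W_ge_U[OF assms] \<open>1/4 < c\<close> by (intro mult_left_mono) auto
  then have "1/4 * W r + (c - 1/4) * U k r \<le> c * W r" for r
    by (simp add: algebra_simps)
  with \<open>1/4 < c\<close> show "\<not> positive_bessel_solution {0<..<R} (\<lambda>r. c * W r) y"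
    by (intro no_positive_solution[of "c - 1/4"]) auto
qed simp

section \<open>Instantiation to the two logarithmic families\<close>

lemma iter_log_gt_exp_tower:
  assumes "exp_tower (i + j) < x"
  shows "exp_tower j < iter_log i x"
  using assms
proof (induction i arbitrary: j)
  case (Suc i)
  \<comment> \<open>The induction is used with the taller tower; the next logarithm removes its
    extra exponential.\<close>
  have "exp_tower (Suc j) < iter_log i x"
    by (rule Suc.IH) (use Suc.prems in simp)
  moreover have "0 < exp_tower (Suc j)" by (simp add: exp_tower_def)
  ultimately have "ln (exp_tower (Suc j)) < ln (iter_log i x)"
    by simp
  then show ?case by (simp add: exp_tower_def iter_log_def)
qed (simp add: iter_log_def)

lemma exp_tower_pos: "0 < exp_tower j"
  by (cases j) (auto simp: exp_tower_def)

text \<open>For r < R the quotient \<rho> / r exceeds E_k, and i \<le> k logarithms still leave it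
  above a tower of height k - i, hence positive.\<close>

lemma log_chain_iter_log:
  assumes "0 < R" "R * exp_tower k < \<rho>"
  shows "log_chain 0 \<rho> R k"
proof
  show "0 < \<rho>" using assms exp_tower_pos[of k] by (meson less_trans mult_pos_pos)
  fix i r assume i: "1 \<le> i" "i \<le> k" and r: "0 < r" "r < R"
  have "r * exp_tower k \<le> R * exp_tower k"
    using r exp_tower_pos[of k] by (intro mult_right_mono) auto
  then have "exp_tower k < \<rho> / r"
    using r assms by (simp add: field_simps)
  then have "exp_tower (k - i) < iter_log i (\<rho> / r)"
    using i by (intro iter_log_gt_exp_tower) auto
  then show "0 < ((\<lambda>x. 0 + ln x) ^^ i) (\<rho> / r)"
    using exp_tower_pos[of "k - i"] by (simp add: iter_log_def)
qed (rule assms)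

text \<open>Agreement on an open interval transfers the derivatives. This is for
  \<open>log_phi\<close> and \<open>X_phi\<close>, identified with \<phi> only where the product is
  positive.\<close>

lemma positive_bessel_solution_cong:
  assumes f: "positive_bessel_solution {0<..<R} V f" and eq: "\<And>r. 0 < r \<Longrightarrow> r < R \<Longrightarrow> f r = g r"
  shows "positive_bessel_solution {0<..<R} V g"
proof -
  obtain f' f'' where sol: "\<forall>r\<in>{0<..<R}. (f has_real_derivative f' r) (at r) \<and>
      (f' has_real_derivative f'' r) (at r) \<and> f'' r + 1 / r * f' r + V r * f r = 0"
    and pos: "\<forall>r\<in>{0<..<R}. 0 < f r"
    using f unfolding positive_bessel_solution_def bessel_solution_def by auto
  have "(g has_real_derivative f' r) (at r)" if r: "r \<in> {0<..<R}" for r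
    using has_field_derivative_transform_within_open[OF _ open_greaterThanLessThan r, of f "f' r" g]
      sol r eq by simp
  moreover have "f r = g r" if "r \<in> {0<..<R}" for r using that eq by simp
  ultimately show ?thesis
    unfolding positive_bessel_solution_def bessel_solution_def
    using sol pos by (intro conjI exI[of _ f'] exI[of _ f'']) auto
qed

lemma (in log_chain) critical_potential:
  assumes "1 \<le> k" and W': "W' = W" and U': "U' = U k"
    and \<phi>': "\<And>r. 0 < r \<Longrightarrow> r < R \<Longrightarrow> \<phi>' r = \<phi> r"
  shows "positive_bessel_solution {0<..<R} (\<lambda>r. 1/4 * W' r) \<phi>'
         \<and> (\<forall>lam>0. \<not> (\<exists>y. positive_bessel_solution {0<..<R} (\<lambda>r. 1/4 * W' r + lam * U' r) y))
         \<and> bessel_potential W' R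
         \<and> bessel_weight W' R = ereal (1/4)"
  unfolding W' U'
proof (intro conjI)
  show "positive_bessel_solution {0<..<R} (\<lambda>r. 1/4 * W r) \<phi>'"
    by (rule positive_bessel_solution_cong[OF positive_solution_\<phi> \<phi>'[symmetric]])
  show "\<forall>lam>0. \<not> (\<exists>y. positive_bessel_solution {0<..<R} (\<lambda>r. 1/4 * W r + lam * U k r) y)"
    using no_positive_solution[OF _ order_refl] by blast
qed (rule bessel_potential_W, rule bessel_weight_W[OF assms(1)])

lemma log_family:
  assumes "1 \<le> k" and R: "0 < R" "R * exp_tower k < \<rho>"
  shows "positive_bessel_solution {0<..<R} (\<lambda>r. 1/4 * log_W k \<rho> r) (log_phi k \<rho>)
         \<and> (\<forall>lam>0. \<not> (\<exists>y. positive_bessel_solution {0<..<R}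
                               (\<lambda>r. 1/4 * log_W k \<rho> r + lam * log_U k \<rho> r) y))
         \<and> bessel_potential (log_W k \<rho>) R
         \<and> bessel_weight (log_W k \<rho>) R = ereal (1/4)"
proof -
  interpret log_chain 0 \<rho> R k using R by (rule log_chain_iter_log)
  have P: "(\<Prod>i=1..j. iter_log i (\<rho> / r)) = P j r" for j r
    by (simp add: P_def L_def iter_log_def)
  have U: "log_U j \<rho> = U j" for j
    by (simp add: fun_eq_iff log_U_def U_def P power_int_minus power_one_over inverse_eq_divide
        del: One_nat_def)
  have W: "log_W k \<rho> = W"
    by (simp add: fun_eq_iff log_W_def W_def U)
  have "log_phi k \<rho> r = \<phi> r" if "0 < r" "r < R" for r
    using P_pos[of k r] that unfolding log_phi_def P \<phi>_def by (simp add: powr_half_sqrt)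
  with assms(1) W U show ?thesis by (rule critical_potential)
qed

text \<open>The recursion is 1 / X_1(t) = 1 - ln t = 1 + ln (1 / t), so passing to reciprocals gives
  the chain with s = 1.\<close>

lemma inverse_X_eq: "inverse (X i t) = ((\<lambda>x. 1 + ln x) ^^ i) (1 / t)"
proof (induction i)
  case (Suc i)
  have "inverse (X (Suc i) t) = 1 + ln (inverse (X i t))"
    by (simp add: X_def X1_def ln_inverse)
  then show ?case using Suc by simp
qed (simp add: X_def inverse_eq_divide)

text \<open>The shift by 1 keeps the chain above 1 when it starts at R / r > 1, so here \<rho> = R
  is large enough for every k.\<close>

lemma funpow_one_plus_ln_gt_1: "1 < x \<Longrightarrow> 1 < ((\<lambda>x. 1 + ln x) ^^ i) (x :: real)"
  by (induction i) auto

lemma log_chain_X: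
  assumes "0 < R"
  shows "log_chain 1 R R k"
proof
  fix i r assume "0 < r" "r < R"
  then have "1 < ((\<lambda>x. 1 + ln x) ^^ i) (R / r)"
    by (intro funpow_one_plus_ln_gt_1) simp
  then show "0 < ((\<lambda>x. 1 + ln x) ^^ i) (R / r)" by simp
qed (rule assms)+

lemma X_family:
  assumes "1 \<le> k" and R: "0 < R"
  shows "positive_bessel_solution {0<..<R} (\<lambda>r. 1/4 * X_W k R r) (X_phi k R)
         \<and> (\<forall>lam>0. \<not> (\<exists>y. positive_bessel_solution {0<..<R}
                               (\<lambda>r. 1/4 * X_W k R r + lam * X_U k R r) y))
         \<and> bessel_potential (X_W k R) R
         \<and> bessel_weight (X_W k R) R = ereal (1/4)"
proof -
  interpret log_chain 1 R R k using R by (rule log_chain_X)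
  have L: "X i (r / R) = inverse (L i r)" for i r
    using inverse_X_eq[of i "r / R", symmetric] by (simp add: L_def)
  have P: "(\<Prod>i=1..j. X i (r / R)) = inverse (P j r)" for j r
    by (simp add: P_def L prod_inversef[symmetric] o_def)
  have U: "X_U j R = U j" for j
    by (simp only: fun_eq_iff X_U_def U_def prod_power_distrib[symmetric] P inverse_eq_divide simp_thms)
  have W: "X_W k R = W"
    by (simp add: fun_eq_iff X_W_def W_def U)
  have "X_phi k R r = \<phi> r" if "0 < r" "r < R" for r
    using P_pos[of k r] that unfolding X_phi_def P \<phi>_def
    by (simp add: powr_minus powr_half_sqrt real_sqrt_inverse)
  with assms(1) W U show ?thesis by (rule critical_potential)
qed

theorem theorem5p1:
  shows "(\<forall>R>0. bessel_potential (\<lambda>r. 0) R)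
    \<and>
      (positive_bessel_solution {0<..<bessel_z0} (\<lambda>r. 1) bessel_J0
       \<and> bessel_J0 bessel_z0 = 0 \<and> 2.4048 \<le> bessel_z0 \<and> bessel_z0 < 2.4049
       \<and> (\<forall>I y. (I = {0<..} \<or> (\<exists>R\<ge>bessel_z0. I = {0<..<R})) \<longrightarrow>
             bessel_solution I (\<lambda>r. 1) y \<longrightarrow>
             \<not> (\<exists>c. \<forall>r\<in>I. y r = c * bessel_J0 r) \<longrightarrow>
             (\<exists>x. 0 < x \<and> x < bessel_z0 \<and> y x = 0 \<and> (\<forall>r\<in>{0<..<x}. y r \<noteq> 0)))
       \<and> (\<forall>R>0. bessel_potential (\<lambda>r. 1) R
                \<and> bessel_weight (\<lambda>r. 1) R = ereal (bessel_z0\<^sup>2 / R\<^sup>2)))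
    \<and>
      (\<forall>a<2. \<exists>R\<^sub>a>0. bessel_potential (\<lambda>r. r powr (- a)) R\<^sub>a)
    \<and>
      (\<forall>k\<ge>1. \<forall>R>0. \<forall>\<rho>>R * exp_tower k.
         positive_bessel_solution {0<..<R} (\<lambda>r. 1/4 * log_W k \<rho> r) (log_phi k \<rho>)
         \<and> (\<forall>lam>0. \<not> (\<exists>y. positive_bessel_solution {0<..<R}
                               (\<lambda>r. 1/4 * log_W k \<rho> r + lam * log_U k \<rho> r) y))
         \<and> bessel_potential (log_W k \<rho>) R
         \<and> bessel_weight (log_W k \<rho>) R = ereal (1/4))
    \<and>
      (\<forall>k\<ge>1. \<forall>R>0.
         positive_bessel_solution {0<..<R} (\<lambda>r. 1/4 * X_W k R r) (X_phi k R)
         \<and> (\<forall>lam>0. \<not> (\<exists>y. positive_bessel_solution {0<..<R}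
                               (\<lambda>r. 1/4 * X_W k R r + lam * X_U k R r) y))
         \<and> bessel_potential (X_W k R) R
         \<and> bessel_weight (X_W k R) R = ereal (1/4))"
proof (intro conjI)
  show "positive_bessel_solution {0<..<bessel_z0} (\<lambda>r. 1) bessel_J0"
    by (rule positive_solution_J0)
  show "\<forall>I y. (I = {0<..} \<or> (\<exists>R\<ge>bessel_z0. I = {0<..<R})) \<longrightarrow>
      bessel_solution I (\<lambda>r. 1) y \<longrightarrow> \<not> (\<exists>c. \<forall>r\<in>I. y r = c * bessel_J0 r) \<longrightarrow>
      (\<exists>x. 0 < x \<and> x < bessel_z0 \<and> y x = 0 \<and> (\<forall>r\<in>{0<..<x}. y r \<noteq> 0))"
    by (intro allI impI) (rule first_zero_less_bessel_z0)
qed (intro allI impI zero_potential bessel_z0_props conjI[OF constant_potential] power_potential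
      log_family X_family; assumption)+

end
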